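(* Let $\Delta x,\Delta t>0$, let $T_\Delta\ge1$ be an integer, and let $V:\mathbb{R}\to\mathbb{R}$ be the Greenshields function $V(\rho)=1-\rho$ or a cut variation of it. Let $(\rho_j^n)_{j\in\mathbb{Z},\,n\ge -T_\Delta}$ be real numbers satisfying the altered Lax-Friedrichs scheme $$\rho_j^{n+1}=\frac12\big(\rho_{j+1}^n+\rho_{j-1}^n\big)-\frac{\Delta t}{2\Delta x}\Big(V(\rho_{j+1}^{n-T_\Delta})\,\rho_{j+1}^{n}-V(\rho_{j-1}^{n-T_\Delta})\,\rho_{j-1}^{n}\Big)\qquad\text{for all } j\in\mathbb{Z},\ n\ge0,$$ with initial history constant in time, $\rho_j^{n}=\rho_j^0$ for $-T_\Delta\le n\le 0$, and with $\rho_j^0\neq0$ for only finitely many $j$. Then the scheme conserves mass: for every $n\ge0$, $$\Delta x\sum_{j\in\mathbb{Z}}\rho_j^{n+1}=\Delta x\sum_{j\in\mathbb{Z}}\rho_j^{n}.$$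
   Context: The scheme is a finite difference discretization of the delayed Lighthill-Whitham-Richards traffic model $\partial_t\rho(x,t)+\partial_x(\rho(x,t)V(\rho(x,t-T)))=0$ on the grid $x_j=j\Delta x$, $t^n=n\Delta t$, where $\rho_j^n$ approximates the density at $(x_j,t^n)$ and $T_\Delta$ is the number of time steps making up the delay $T$ (with $\Delta t\le T$). Densities and velocities are normalized so that $\rho_{\max}=V_{\max}=1$. A cut variation of the Greenshields function is a truncation $V(\rho)=\max\{m,\min\{M,1-\rho\}\}$ with constants $-1\le m\le M\le 1$, so that $|V(\rho)|\le\rho_{\max}=1$. *)

theory Defs
  imports "HOL-Analysis.Analysis"
begin

text \<open>
  The time index \<open>n\<close> of a grid function \<open>\<rho> j n\<close> is an integer because the delay reaches back to
  \<open>n = - T\<close>; values of \<open>\<rho>\<close> at times \<open>n < - T\<close> are never used.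
\<close>

definition greenshields :: "real \<Rightarrow> real" where
  "greenshields r = 1 - r"

definition cut_greenshields :: "real \<Rightarrow> real \<Rightarrow> real \<Rightarrow> real" where
  "cut_greenshields m M r = max m (min M (greenshields r))"

definition greenshields_or_cut :: "(real \<Rightarrow> real) \<Rightarrow> bool" where
  "greenshields_or_cut V \<longleftrightarrow>
     V = greenshields \<or> (\<exists>m M. -1 \<le> m \<and> m \<le> M \<and> M \<le> 1 \<and> V = cut_greenshields m M)"

definition altered_lax_friedrichs ::
  "real \<Rightarrow> real \<Rightarrow> int \<Rightarrow> (real \<Rightarrow> real) \<Rightarrow> (int \<Rightarrow> int \<Rightarrow> real) \<Rightarrow> bool" where
  "altered_lax_friedrichs dx dt T V \<rho> \<longleftrightarrow>
     (\<forall>j. \<forall>n\<ge>0. \<rho> j (n + 1) =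
        1 / 2 * (\<rho> (j + 1) n + \<rho> (j - 1) n)
        - dt / (2 * dx) * (V (\<rho> (j + 1) (n - T)) * \<rho> (j + 1) n
                           - V (\<rho> (j - 1) (n - T)) * \<rho> (j - 1) n))"

definition constant_history :: "int \<Rightarrow> (int \<Rightarrow> int \<Rightarrow> real) \<Rightarrow> bool" where
  "constant_history T \<rho> \<longleftrightarrow> (\<forall>j n. - T \<le> n \<and> n \<le> 0 \<longrightarrow> \<rho> j n = \<rho> j 0)"

end

(* Each update is rho_j^{n+1} = a_{j+1} + b_{j-1}, where a_i and b_i depend on site i only and
   a_i + b_i = rho_i^n; shifting the two sums separately gives conservation.  The sums are
   finite because the support grows by at most one cell on each side per step. *)
theory Submission
  imports Defs
begin

lemma infsum_shift_int:
  fixes f :: "int \<Rightarrow> 'a::{comm_monoid_add, t2_space}"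
  shows "(\<Sum>\<^sub>\<infinity>j. f (j + k)) = (\<Sum>\<^sub>\<infinity>j. f j)"
  by (rule infsum_reindex_bij_betw) (rule bij_plus_right)

lemma summable_on_shift_int:
  fixes f :: "int \<Rightarrow> 'a::{comm_monoid_add, t2_space}"
  shows "(\<lambda>j. f (j + k)) summable_on UNIV \<longleftrightarrow> f summable_on UNIV"
  by (rule summable_on_reindex_bij_betw) (rule bij_plus_right)

text \<open>Summability of \<open>a\<close> and \<open>b\<close> separately is what allows the sum
  to be split before each half is translated. Summability of \<open>a + b\<close> would not do: for
  \<open>a\<close> the indicator of j \<ge> 0, \<open>b = -a\<close> and \<open>k = 1\<close>, the
  left side is 2 and the right side 0.\<close>

lemma infsum_opposite_shifts_int:
  fixes a b :: "int \<Rightarrow> real"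
  assumes "a summable_on UNIV" and "b summable_on UNIV"
  shows "(\<Sum>\<^sub>\<infinity>j. a (j + k) + b (j - k)) = (\<Sum>\<^sub>\<infinity>j. a j + b j)"
proof -
  have "(\<lambda>j. a (j + k)) summable_on UNIV" "(\<lambda>j. b (j - k)) summable_on UNIV"
    using assms summable_on_shift_int[of a k] summable_on_shift_int[of b "- k"] by simp_all
  then show ?thesis
    using assms infsum_shift_int[of a k] infsum_shift_int[of b "- k"]
    by (simp add: infsum_add)
qed

text \<open>Delayed densities enter only through \<open>V\<close>, and every term of the update
  carries a factor \<rho> at time n, so the support at n alone controls the support at n +
  1.\<close>

lemma altered_lax_friedrichs_finite_support:
  assumes scheme: "altered_lax_friedrichs dx dt T V \<rho>"
    and init: "finite {j. \<rho> j 0 \<noteq> 0}"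
    and "n \<ge> 0"
  shows "finite {j. \<rho> j n \<noteq> 0}"
  using \<open>n \<ge> 0\<close>
proof (induction n rule: int_ge_induct)
  case base
  show ?case by (fact init)
next
  case (step n)
  let ?S = "{j. \<rho> j n \<noteq> 0}"
  \<comment> \<open>Contrapositive: if both neighbours of j vanish at time n, so does the update at
    j.\<close>
  have "{j. \<rho> j (n + 1) \<noteq> 0} \<subseteq> (\<lambda>j. j - 1) ` ?S \<union> (\<lambda>j. j + 1) ` ?S"
  proof
    fix j assume "j \<in> {j. \<rho> j (n + 1) \<noteq> 0}"
    then have "\<rho> (j + 1) n \<noteq> 0 \<or> \<rho> (j - 1) n \<noteq> 0"
      using scheme \<open>0 \<le> n\<close> by (auto simp: altered_lax_friedrichs_def)
    then show "j \<in> (\<lambda>j. j - 1) ` ?S \<union> (\<lambda>j. j + 1) ` ?S"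
      by (force simp: image_iff)
  qed
  then show ?case
    using step.IH by (meson finite_UnI finite_imageI finite_subset)
qed

theorem mainTheorem4:
  fixes dx dt :: real and T :: int and V :: "real \<Rightarrow> real" and \<rho> :: "int \<Rightarrow> int \<Rightarrow> real"
  assumes "dx > 0" and "dt > 0" and "T \<ge> 1"
    and "greenshields_or_cut V"
    and "altered_lax_friedrichs dx dt T V \<rho>"
    and "constant_history T \<rho>"
    and "finite {j. \<rho> j 0 \<noteq> 0}"
  shows "\<forall>n\<ge>0. (\<lambda>j. \<rho> j n) summable_on UNIV \<and> (\<lambda>j. \<rho> j (n + 1)) summable_on UNIV \<and>
           dx * (\<Sum>\<^sub>\<infinity>j. \<rho> j (n + 1)) = dx * (\<Sum>\<^sub>\<infinity>j. \<rho> j n)"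
proof (intro allI impI)
  fix n :: int assume n: "0 \<le> n"
  note scheme = \<open>altered_lax_friedrichs dx dt T V \<rho>\<close>
  note support = altered_lax_friedrichs_finite_support[OF scheme \<open>finite {j. \<rho> j 0 \<noteq> 0}\<close>]
  \<comment> \<open>Used at both n and n + 1, so that neither sum is the default value 0 of a
    divergent \<open>infsum\<close>.\<close>
  have summable: "(\<lambda>j. \<rho> j k) summable_on UNIV" if "k \<ge> 0" for k
    using support[OF that] by (intro finite_nonzero_values_imp_summable_on) simp
  \<comment> \<open>Both the current and the delayed density are taken at site j. Hence
    \<open>a j\<close> is the share that site j passes to j - 1, and \<open>b j\<close> the share it
    passes to j + 1.\<close>
  define flux where "flux j = dt / (2 * dx) * (V (\<rho> j (n - T)) * \<rho> j n)" for j
  define a where "a j = \<rho> j n / 2 - flux j" for j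
  define b where "b j = \<rho> j n / 2 + flux j" for j
  \<comment> \<open>\<open>flux j\<close> has the factor \<open>\<rho> j n\<close>, so both shares
    vanish wherever the density does.\<close>
  have "{j. a j \<noteq> 0} \<subseteq> {j. \<rho> j n \<noteq> 0}" "{j. b j \<noteq> 0} \<subseteq> {j. \<rho> j n \<noteq> 0}"
    by (auto simp: a_def b_def flux_def)
  then have "a summable_on UNIV" "b summable_on UNIV"
    using finite_subset[OF _ support[OF n]]
    by (auto intro!: finite_nonzero_values_imp_summable_on)
  then have "(\<Sum>\<^sub>\<infinity>j. a (j + 1) + b (j - 1)) = (\<Sum>\<^sub>\<infinity>j. a j + b j)"
    by (rule infsum_opposite_shifts_int)
  moreover have "\<rho> j (n + 1) = a (j + 1) + b (j - 1)" for j
    using scheme n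
    by (simp add: altered_lax_friedrichs_def a_def b_def flux_def right_diff_distrib add_divide_distrib)
  moreover have "a j + b j = \<rho> j n" for j
    by (simp add: a_def b_def)
  ultimately have "(\<Sum>\<^sub>\<infinity>j. \<rho> j (n + 1)) = (\<Sum>\<^sub>\<infinity>j. \<rho> j n)"
    by simp
  then show "(\<lambda>j. \<rho> j n) summable_on UNIV \<and> (\<lambda>j. \<rho> j (n + 1)) summable_on UNIV \<and>
      dx * (\<Sum>\<^sub>\<infinity>j. \<rho> j (n + 1)) = dx * (\<Sum>\<^sub>\<infinity>j. \<rho> j n)"
    using summable n by simp
qed

end
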